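(* Let $(G,\cdot)$ be a Smarandache loop with S-subgroup $H$. Then $SBS(G,\cdot)$ (formed relative to $H$) is a subgroup of the Bryant-Schneider group $BS(G,\cdot)$, i.e. $SBS(G,\cdot)\le BS(G,\cdot)$.
   Context: A loop is a quasigroup with two-sided identity $e$. A Smarandache loop (S-loop) is a loop $(G,\cdot)$ having a subset $H$ such that $(H,\cdot)$ is a non-trivial subgroup (a subloop that is a group, $\{e\}\ne H\ne G$); $H$ is called an S-subgroup. Maps are written on the right and composed left to right ($x\alpha\beta=(x\alpha)\beta$). $SYM(G,\cdot)$ is the group of all bijections of $G$. $yL_x=x\cdot y$ and $yR_x=y\cdot x$ are the left and right translations. $AUT(G,\cdot)$ is the group (under componentwise composition) of autotopisms, i.e. triples $(U,V,W)\in SYM(G)^3$ with $xU\cdot yV=(x\cdot y)W$ for all $x,y\in G$. $BS(G,\cdot)=\{\theta\in SYM(G,\cdot): \exists f,g\in G,\ (\theta R_g^{-1},\theta L_f^{-1},\theta)\in AUT(G,\cdot)\}$, a group under composition. For a fixed S-subgroup $H$: $SSYM(G,\cdot)$ consists of all $\theta\in SYM(G,\cdot)$ such that $h\theta\in H$ for all $h\in H$, and $SBS(G,\cdot)=\{\theta\in SSYM(G,\cdot): \exists f,g\in H,\ (\theta R_g^{-1},\theta L_f^{-1},\theta)\in AUT(G,\cdot)\}$.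
   Formalization: SSYM(G,·) is taken as all θ in SYM(G,·) with Hθ = H instead of only hθ ∈ H for all h ∈ H; with the latter the claim fails for infinite H (G = (Q,+), H = Z, θ doubling, f = g = 0); for finite H the two agree. *)

theory Defs
  imports "HOL-Algebra.Bij"
begin

locale quasigroup =
  fixes G (structure)
  assumes m_closed [intro, simp]:
      "\<lbrakk>x \<in> carrier G; y \<in> carrier G\<rbrakk> \<Longrightarrow> x \<otimes> y \<in> carrier G"
    and left_division:
      "\<lbrakk>a \<in> carrier G; b \<in> carrier G\<rbrakk> \<Longrightarrow> \<exists>!x. x \<in> carrier G \<and> a \<otimes> x = b"
    and right_division:
      "\<lbrakk>a \<in> carrier G; b \<in> carrier G\<rbrakk> \<Longrightarrow> \<exists>!y. y \<in> carrier G \<and> y \<otimes> a = b"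

locale loop = quasigroup +
  assumes one_closed [intro, simp]: "\<one> \<in> carrier G"
    and l_one [simp]: "x \<in> carrier G \<Longrightarrow> \<one> \<otimes> x = x"
    and r_one [simp]: "x \<in> carrier G \<Longrightarrow> x \<otimes> \<one> = x"

locale Smarandache_loop = loop +
  fixes H
  assumes H_subset: "H \<subseteq> carrier G"
    and H_group: "group (G\<lparr>carrier := H\<rparr>)"
    and H_not_trivial: "H \<noteq> {\<one>}"
    and H_proper: "H \<noteq> carrier G"

(* Maps act on the right, so the product of \<alpha> and \<beta> is "first \<alpha>, then \<beta>", opposite to
   BijGroup. As in Bij, permutations of the carrier are extensional functions. *)
definition SYM :: "('a, 'b) monoid_scheme \<Rightarrow> ('a \<Rightarrow> 'a) monoid" where
  "SYM G = \<lparr>carrier = Bij (carrier G),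
            mult = (\<lambda>\<alpha> \<beta>. compose (carrier G) \<beta> \<alpha>),
            one = (\<lambda>x \<in> carrier G. x)\<rparr>"

definition Ltrans :: "('a, 'b) monoid_scheme \<Rightarrow> 'a \<Rightarrow> 'a \<Rightarrow> 'a" where
  "Ltrans G x = (\<lambda>y \<in> carrier G. x \<otimes>\<^bsub>G\<^esub> y)"

definition Rtrans :: "('a, 'b) monoid_scheme \<Rightarrow> 'a \<Rightarrow> 'a \<Rightarrow> 'a" where
  "Rtrans G x = (\<lambda>y \<in> carrier G. y \<otimes>\<^bsub>G\<^esub> x)"

definition AUT :: "('a, 'b) monoid_scheme \<Rightarrow> (('a \<Rightarrow> 'a) \<times> ('a \<Rightarrow> 'a) \<times> ('a \<Rightarrow> 'a)) set" where
  "AUT G = {(U, V, W).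
     U \<in> carrier (SYM G) \<and> V \<in> carrier (SYM G) \<and> W \<in> carrier (SYM G) \<and>
     (\<forall>x \<in> carrier G. \<forall>y \<in> carrier G. U x \<otimes>\<^bsub>G\<^esub> V y = W (x \<otimes>\<^bsub>G\<^esub> y))}"

definition BS :: "('a, 'b) monoid_scheme \<Rightarrow> ('a \<Rightarrow> 'a) set" where
  "BS G = {\<theta> \<in> carrier (SYM G). \<exists>f \<in> carrier G. \<exists>g \<in> carrier G.
     (\<theta> \<otimes>\<^bsub>SYM G\<^esub> inv\<^bsub>SYM G\<^esub> (Rtrans G g), \<theta> \<otimes>\<^bsub>SYM G\<^esub> inv\<^bsub>SYM G\<^esub> (Ltrans G f), \<theta>) \<in> AUT G}"

definition BS_group :: "('a, 'b) monoid_scheme \<Rightarrow> ('a \<Rightarrow> 'a) monoid" where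
  "BS_group G = (SYM G)\<lparr>carrier := BS G\<rparr>"

(* The Smarandache permutations: permutations of G that restrict to permutations of H.
   The one-sided condition "\<theta> h \<in> H for all h \<in> H" is the same when H is finite (lemma below),
   but for infinite H it is not stable under inverses: in the rationals under addition with
   H the integers, doubling maps H into H and its inverse does not, so with the one-sided
   condition neither SSYM nor SBS would be a group. *)
definition SSYM :: "('a, 'b) monoid_scheme \<Rightarrow> 'a set \<Rightarrow> ('a \<Rightarrow> 'a) set" where
  "SSYM G H = {\<theta> \<in> carrier (SYM G). \<theta> ` H = H}"

definition SBS :: "('a, 'b) monoid_scheme \<Rightarrow> 'a set \<Rightarrow> ('a \<Rightarrow> 'a) set" where
  "SBS G H = {\<theta> \<in> SSYM G H. \<exists>f \<in> H. \<exists>g \<in> H.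
     (\<theta> \<otimes>\<^bsub>SYM G\<^esub> inv\<^bsub>SYM G\<^esub> (Rtrans G g), \<theta> \<otimes>\<^bsub>SYM G\<^esub> inv\<^bsub>SYM G\<^esub> (Ltrans G f), \<theta>) \<in> AUT G}"

lemma SSYM_finite:
  assumes "H \<subseteq> carrier G" and "finite H"
  shows "SSYM G H = {\<theta> \<in> carrier (SYM G). \<forall>h \<in> H. \<theta> h \<in> H}"
proof -
  have "\<theta> ` H = H" if "\<theta> \<in> carrier (SYM G)" "\<forall>h \<in> H. \<theta> h \<in> H" for \<theta>
  proof (rule endo_inj_surj[OF assms(2)])
    show "\<theta> ` H \<subseteq> H" using that(2) by blast
    show "inj_on \<theta> H"
      using that(1) assms(1) unfolding SYM_def Bij_def bij_betw_def
      by (auto intro: inj_on_subset)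
  qed
  then show ?thesis unfolding SSYM_def by blast
qed

end

theory Submission
  imports Defs
begin

text \<open>
  Every autotopism \<open>(U, V, \<theta>)\<close> satisfies \<open>\<theta> = U R\<^sub>g = V L\<^sub>f\<close> with \<open>g = e V\<close> and \<open>f = e U\<close>, so
  \<open>BS\<close> consists of the third components of autotopisms. If moreover \<open>\<theta>\<close> permutes \<open>H\<close> and \<open>f\<close>, \<open>g\<close>
  lie in \<open>H\<close>, then \<open>U\<close> and \<open>V\<close> permute \<open>H\<close> as well, and conversely. Hence \<open>SBS\<close> consists of the
  third components of those autotopisms all of whose components permute \<open>H\<close>. Both descriptions
  are visibly closed under products and inverses.
\<close>

section \<open>The symmetric group of the carrier, and the permutations preserving a subset\<close>

lemma carrier_SYM: "carrier (SYM G) = Bij (carrier G)"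
  by (simp add: SYM_def)

lemma one_SYM: "\<one>\<^bsub>SYM G\<^esub> = (\<lambda>x \<in> carrier G. x)"
  by (simp add: SYM_def)

lemma SYM_mult_apply: "x \<in> carrier G \<Longrightarrow> (\<alpha> \<otimes>\<^bsub>SYM G\<^esub> \<beta>) x = \<beta> (\<alpha> x)"
  by (simp add: SYM_def compose_def)

lemma SYM_closed: "\<alpha> \<in> carrier (SYM G) \<Longrightarrow> x \<in> carrier G \<Longrightarrow> \<alpha> x \<in> carrier G"
  by (auto simp: carrier_SYM dest: Bij_imp_funcset)

text \<open>Permutations are extensional here, so both take the value \<open>undefined\<close> off
  the carrier.\<close>

lemma SYM_eqI:
  assumes "\<alpha> \<in> carrier (SYM G)" "\<beta> \<in> carrier (SYM G)"
    and "\<And>x. x \<in> carrier G \<Longrightarrow> \<alpha> x = \<beta> x"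
  shows "\<alpha> = \<beta>"
  using assms by (auto simp: carrier_SYM Bij_def intro: extensionalityI)

lemma SYM_m_closed:
  "\<alpha> \<in> carrier (SYM G) \<Longrightarrow> \<beta> \<in> carrier (SYM G) \<Longrightarrow> \<alpha> \<otimes>\<^bsub>SYM G\<^esub> \<beta> \<in> carrier (SYM G)"
  by (simp add: SYM_def compose_Bij)

lemma group_SYM: "group (SYM G)"
proof (rule groupI)
  fix \<alpha> assume "\<alpha> \<in> carrier (SYM G)"
  then have \<alpha>: "\<alpha> \<in> Bij (carrier G)" by (simp add: carrier_SYM)
  \<comment> \<open>\<open>groupI\<close> asks for a left inverse only. The product applies \<beta>
    first, so \<beta> must pick preimages under \<alpha>, and these exist by surjectivity.\<close>
  then have "\<alpha> ` carrier G = carrier G" by (simp add: Bij_def bij_betw_def)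
  then show "\<exists>\<beta> \<in> carrier (SYM G). \<beta> \<otimes>\<^bsub>SYM G\<^esub> \<alpha> = \<one>\<^bsub>SYM G\<^esub>"
    using restrict_inv_into_Bij[OF \<alpha>]
    by (intro bexI[of _ "restrict (inv_into (carrier G) \<alpha>) (carrier G)"])
      (auto simp: SYM_def compose_def f_inv_into_f fun_eq_iff)
next
  fix \<alpha> \<beta> assume "\<alpha> \<in> carrier (SYM G)" "\<beta> \<in> carrier (SYM G)"
  then show "\<alpha> \<otimes>\<^bsub>SYM G\<^esub> \<beta> \<in> carrier (SYM G)" by (rule SYM_m_closed)
next
  fix \<alpha> assume "\<alpha> \<in> carrier (SYM G)"
  then show "\<one>\<^bsub>SYM G\<^esub> \<otimes>\<^bsub>SYM G\<^esub> \<alpha> = \<alpha>"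
    by (auto simp: SYM_def compose_def Bij_def extensional_def)
next
  fix \<alpha> \<beta> \<gamma> assume "\<alpha> \<in> carrier (SYM G)"
  then show "\<alpha> \<otimes>\<^bsub>SYM G\<^esub> \<beta> \<otimes>\<^bsub>SYM G\<^esub> \<gamma> = \<alpha> \<otimes>\<^bsub>SYM G\<^esub> (\<beta> \<otimes>\<^bsub>SYM G\<^esub> \<gamma>)"
    by (simp add: SYM_def compose_assoc Bij_imp_funcset)
qed (simp add: SYM_def id_Bij)

lemma SYM_inv_apply:
  assumes "\<alpha> \<in> carrier (SYM G)" "x \<in> carrier G"
  shows "\<alpha> ((inv\<^bsub>SYM G\<^esub> \<alpha>) x) = x" "(inv\<^bsub>SYM G\<^esub> \<alpha>) (\<alpha> x) = x"
  using group.l_inv[OF group_SYM assms(1)] group.r_inv[OF group_SYM assms(1)] assms(2)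
  by (metis SYM_mult_apply one_SYM restrict_apply')+

lemma AUT_apply:
  "(U, V, W) \<in> AUT G \<Longrightarrow> x \<in> carrier G \<Longrightarrow> y \<in> carrier G \<Longrightarrow> U x \<otimes>\<^bsub>G\<^esub> V y = W (x \<otimes>\<^bsub>G\<^esub> y)"
  by (simp add: AUT_def)

lemma AUT_SYM:
  assumes "(U, V, W) \<in> AUT G"
  shows "U \<in> carrier (SYM G)" "V \<in> carrier (SYM G)" "W \<in> carrier (SYM G)"
  using assms by (simp_all add: AUT_def)

lemma subgroup_SSYM:
  assumes "H \<subseteq> carrier G"
  shows "subgroup (SSYM G H) (SYM G)"
proof (rule group.subgroupI[OF group_SYM])
  show "SSYM G H \<noteq> {}"
    using group.is_monoid[OF group_SYM, THEN monoid.one_closed, of G] assms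
    by (force simp: SSYM_def one_SYM)
next
  fix \<alpha> assume "\<alpha> \<in> SSYM G H"
  then have \<alpha>: "\<alpha> \<in> carrier (SYM G)" "\<alpha> ` H = H" by (simp_all add: SSYM_def)
  have "(inv\<^bsub>SYM G\<^esub> \<alpha>) ` (\<alpha> ` H) = H"
    using SYM_inv_apply(2)[OF \<alpha>(1)] assms by (force simp: image_image)
  then show "inv\<^bsub>SYM G\<^esub> \<alpha> \<in> SSYM G H"
    using \<alpha> by (simp add: SSYM_def group.inv_closed[OF group_SYM])
next
  fix \<alpha> \<beta> assume "\<alpha> \<in> SSYM G H" "\<beta> \<in> SSYM G H"
  then have ab: "\<alpha> \<in> carrier (SYM G)" "\<alpha> ` H = H" "\<beta> \<in> carrier (SYM G)" "\<beta> ` H = H"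
    by (simp_all add: SSYM_def)
  have "(\<alpha> \<otimes>\<^bsub>SYM G\<^esub> \<beta>) ` H = \<beta> ` (\<alpha> ` H)"
    unfolding image_image using assms by (intro image_cong) (auto simp: SYM_mult_apply)
  then show "\<alpha> \<otimes>\<^bsub>SYM G\<^esub> \<beta> \<in> SSYM G H"
    using ab by (simp add: SSYM_def SYM_m_closed)
qed (simp add: SSYM_def)

section \<open>Cancellation, translations and the group laws for autotopisms\<close>

context quasigroup
begin

lemma l_cancel:
  "a \<otimes> x = a \<otimes> y \<Longrightarrow> a \<in> carrier G \<Longrightarrow> x \<in> carrier G \<Longrightarrow> y \<in> carrier G \<Longrightarrow> x = y"
  using left_division[of a "a \<otimes> x"] by auto

lemma r_cancel:
  "x \<otimes> a = y \<otimes> a \<Longrightarrow> a \<in> carrier G \<Longrightarrow> x \<in> carrier G \<Longrightarrow> y \<in> carrier G \<Longrightarrow> x = y"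
  using right_division[of a "x \<otimes> a"] by auto

lemma Ltrans_SYM:
  assumes "a \<in> carrier G"
  shows "Ltrans G a \<in> carrier (SYM G)"
proof -
  have "b \<in> (\<lambda>x. a \<otimes> x) ` carrier G" if "b \<in> carrier G" for b
    using left_division[OF assms that] by blast
  then show ?thesis
    using assms by (auto simp: carrier_SYM Bij_def bij_betw_def Ltrans_def inj_on_def intro: l_cancel)
qed

lemma Rtrans_SYM:
  assumes "a \<in> carrier G"
  shows "Rtrans G a \<in> carrier (SYM G)"
proof -
  have "b \<in> (\<lambda>x. x \<otimes> a) ` carrier G" if "b \<in> carrier G" for b
    using right_division[OF assms that] by blast
  then show ?thesis
    using assms by (auto simp: carrier_SYM Bij_def bij_betw_def Rtrans_def inj_on_def intro: r_cancel)
qed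

lemma AUT_id: "(\<one>\<^bsub>SYM G\<^esub>, \<one>\<^bsub>SYM G\<^esub>, \<one>\<^bsub>SYM G\<^esub>) \<in> AUT G"
  using group.is_monoid[OF group_SYM, THEN monoid.one_closed, of G]
  by (simp add: AUT_def one_SYM)

lemma AUT_mult:
  assumes "(U, V, W) \<in> AUT G" "(U', V', W') \<in> AUT G"
  shows "(U \<otimes>\<^bsub>SYM G\<^esub> U', V \<otimes>\<^bsub>SYM G\<^esub> V', W \<otimes>\<^bsub>SYM G\<^esub> W') \<in> AUT G"
  using assms
  by (simp add: AUT_def SYM_mult_apply SYM_closed SYM_m_closed)

lemma AUT_inv:
  assumes A: "(U, V, W) \<in> AUT G"
  shows "(inv\<^bsub>SYM G\<^esub> U, inv\<^bsub>SYM G\<^esub> V, inv\<^bsub>SYM G\<^esub> W) \<in> AUT G"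
proof -
  note S = AUT_SYM[OF A]
  note I = S[THEN group.inv_closed[OF group_SYM]]
  have "(inv\<^bsub>SYM G\<^esub> U) x \<otimes> (inv\<^bsub>SYM G\<^esub> V) y = (inv\<^bsub>SYM G\<^esub> W) (x \<otimes> y)"
    if "x \<in> carrier G" "y \<in> carrier G" for x y
  proof -
    let ?u = "(inv\<^bsub>SYM G\<^esub> U) x" and ?v = "(inv\<^bsub>SYM G\<^esub> V) y"
    have uv: "?u \<in> carrier G" "?v \<in> carrier G" using I that by (simp_all add: SYM_closed)
    \<comment> \<open>The autotopism law is taken at the preimages of \<open>x\<close> and
      \<open>y\<close>; applying the inverse of \<open>W\<close> to the result gives the law for the
      inverses.\<close>
    have "W (?u \<otimes> ?v) = x \<otimes> y"
      using AUT_apply[OF A uv] S that by (simp add: SYM_inv_apply(1))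
    then show ?thesis using SYM_inv_apply(2)[OF S(3), of "?u \<otimes> ?v"] uv by simp
  qed
  then show ?thesis using I by (simp add: AUT_def)
qed

end

section \<open>The Bryant-Schneider group through arbitrary autotopisms\<close>

context loop
begin

text \<open>This removes translations from the definitions: \<open>f\<close> and \<open>g\<close>
  become the images of \<open>\<one>\<close> under the first two components, which then determine
  those components.\<close>

lemma AUT_translations_iff:
  assumes "f \<in> carrier G" "g \<in> carrier G" "\<theta> \<in> carrier (SYM G)"
  shows "(\<theta> \<otimes>\<^bsub>SYM G\<^esub> inv\<^bsub>SYM G\<^esub> (Rtrans G g), \<theta> \<otimes>\<^bsub>SYM G\<^esub> inv\<^bsub>SYM G\<^esub> (Ltrans G f), \<theta>) \<in> AUT G
    \<longleftrightarrow> (\<exists>U V. (U, V, \<theta>) \<in> AUT G \<and> U \<one> = f \<and> V \<one> = g)"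
    (is "(?U, ?V, \<theta>) \<in> AUT G \<longleftrightarrow> ?R")
proof
  assume A: "(?U, ?V, \<theta>) \<in> AUT G"
  have c: "?U \<one> \<in> carrier G" "?V \<one> \<in> carrier G"
    using AUT_SYM[OF A] by (simp_all add: SYM_closed)
  have t: "\<theta> \<one> \<in> carrier G" using assms(3) by (simp add: SYM_closed)
  \<comment> \<open>Undoing the inverse translations at \<open>\<one>\<close> gives two
    factorizations of \<open>\<theta> \<one>\<close>. Comparing each with the autotopism law at
    \<open>\<one>\<close>, \<open>\<one>\<close> and cancelling identifies \<open>f\<close> and
    \<open>g\<close>.\<close>
  have "?U \<one> \<otimes> g = \<theta> \<one>" "f \<otimes> ?V \<one> = \<theta> \<one>"
    using SYM_inv_apply(1)[OF Rtrans_SYM[OF assms(2)] t] SYM_inv_apply(1)[OF Ltrans_SYM[OF assms(1)] t]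
      c by (simp_all add: SYM_mult_apply Rtrans_def Ltrans_def)
  moreover have "?U \<one> \<otimes> ?V \<one> = \<theta> \<one>" using AUT_apply[OF A, of \<one> \<one>] by simp
  ultimately have "?V \<one> = g" "?U \<one> = f"
    using c assms by (metis l_cancel, metis r_cancel)
  then show ?R using A by blast
next
  assume ?R
  then obtain U V where A: "(U, V, \<theta>) \<in> AUT G" and f: "U \<one> = f" and g: "V \<one> = g" by blast
  interpret S: group "SYM G" by (rule group_SYM)
  note UV = AUT_SYM[OF A]
  \<comment> \<open>The autotopism law with second argument \<open>\<one>\<close>; below, the first
    argument is \<open>\<one>\<close> instead.\<close>
  have "\<theta> = U \<otimes>\<^bsub>SYM G\<^esub> Rtrans G g"
    using AUT_apply[OF A, of _ \<one>] UV assms g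
    by (intro SYM_eqI[OF _ SYM_m_closed[OF _ Rtrans_SYM]]) (auto simp: SYM_mult_apply Rtrans_def SYM_closed)
  then have "?U = U"
    using UV Rtrans_SYM[OF assms(2)] by (simp add: S.inv_solve_right')
  moreover have "\<theta> = V \<otimes>\<^bsub>SYM G\<^esub> Ltrans G f"
    using AUT_apply[OF A, of \<one>] UV assms f
    by (intro SYM_eqI[OF _ SYM_m_closed[OF _ Ltrans_SYM]]) (auto simp: SYM_mult_apply Ltrans_def SYM_closed)
  then have "?V = V"
    using UV Ltrans_SYM[OF assms(1)] by (simp add: S.inv_solve_right')
  ultimately show "(?U, ?V, \<theta>) \<in> AUT G" using A by simp
qed

text \<open>The images of \<open>\<one>\<close> always lie in the carrier, so every autotopism
  supplies admissible \<open>f\<close> and \<open>g\<close>.\<close>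

lemma BS_eq: "BS G = {\<theta>. \<exists>U V. (U, V, \<theta>) \<in> AUT G}"
proof -
  have "U \<one> \<in> carrier G" "V \<one> \<in> carrier G" if "(U, V, \<theta>) \<in> AUT G" for U V \<theta>
    using AUT_SYM[OF that] by (simp_all add: SYM_closed)
  then show ?thesis
    by (auto simp: BS_def AUT_translations_iff cong: conj_cong dest: AUT_SYM(3)) blast
qed

lemma subgroup_BS: "subgroup (BS G) (SYM G)"
proof (rule group.subgroupI[OF group_SYM])
  show "BS G \<noteq> {}" using AUT_id by (auto simp: BS_eq)
next
  fix \<alpha> assume "\<alpha> \<in> BS G"
  then show "inv\<^bsub>SYM G\<^esub> \<alpha> \<in> BS G" unfolding BS_eq by (auto dest: AUT_inv)
next
  fix \<alpha> \<beta> assume "\<alpha> \<in> BS G" "\<beta> \<in> BS G"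
  then show "\<alpha> \<otimes>\<^bsub>SYM G\<^esub> \<beta> \<in> BS G" unfolding BS_eq by (auto dest: AUT_mult)
qed (auto simp: BS_def)

end

section \<open>Divisions inside the S-subgroup and the group \<open>SBS\<close>\<close>

context Smarandache_loop
begin

lemma H_mult: "x \<in> H \<Longrightarrow> y \<in> H \<Longrightarrow> x \<otimes> y \<in> H"
  using monoid.m_closed[OF group.is_monoid[OF H_group]] by simp

lemma one_in_H: "\<one> \<in> H"
  using monoid.one_closed[OF group.is_monoid[OF H_group]] by simp

text \<open>The equation can be solved inside the group \<open>H\<close>, where associativity holds;
  uniqueness of division in the whole loop forces that solution to be \<open>x\<close>.\<close>

lemma H_left_division:
  assumes "a \<in> H" "x \<in> carrier G" "a \<otimes> x \<in> H"
  shows "x \<in> H"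
proof -
  interpret K: group "G\<lparr>carrier := H\<rparr>" by (rule H_group)
  let ?y = "inv\<^bsub>G\<lparr>carrier := H\<rparr>\<^esub> a \<otimes> (a \<otimes> x)"
  have y: "?y \<in> H" using K.inv_closed assms by (simp add: H_mult)
  have "a \<otimes> ?y = a \<otimes> x"
    using K.m_assoc[of a "inv\<^bsub>G\<lparr>carrier := H\<rparr>\<^esub> a" "a \<otimes> x"] K.inv_closed[of a] K.r_inv[of a]
      K.l_one[of "a \<otimes> x"] assms by simp
  then have "?y = x" using l_cancel y assms H_subset by blast
  then show ?thesis using y by simp
qed

lemma H_right_division:
  assumes "a \<in> H" "x \<in> carrier G" "x \<otimes> a \<in> H"
  shows "x \<in> H"
proof -
  interpret K: group "G\<lparr>carrier := H\<rparr>" by (rule H_group)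
  let ?y = "x \<otimes> a \<otimes> inv\<^bsub>G\<lparr>carrier := H\<rparr>\<^esub> a"
  have y: "?y \<in> H" using K.inv_closed assms by (simp add: H_mult)
  have "?y \<otimes> a = x \<otimes> a"
    using K.m_assoc[of "x \<otimes> a" "inv\<^bsub>G\<lparr>carrier := H\<rparr>\<^esub> a" a] K.inv_closed[of a] K.l_inv[of a]
      K.r_one[of "x \<otimes> a"] assms by simp
  then have "?y = x" using r_cancel y assms H_subset by blast
  then show ?thesis using y by simp
qed

text \<open>Setting one argument to \<open>\<one>\<close> gives
  \<open>U h \<otimes> V \<one> = \<theta> h\<close> and
  \<open>U \<one> \<otimes> V h = \<theta> h\<close>. For \<open>h\<close> in \<open>H\<close>,
  division inside \<open>H\<close> then puts \<open>U h\<close> and \<open>V h\<close> in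
  \<open>H\<close>.\<close>

lemma AUT_SSYM:
  assumes A: "(U, V, \<theta>) \<in> AUT G" and \<theta>: "\<theta> \<in> SSYM G H" and f: "U \<one> \<in> H" and g: "V \<one> \<in> H"
  shows "U \<in> SSYM G H" "V \<in> SSYM G H"
proof -
  note S = AUT_SYM[OF A]
  have H: "h \<in> carrier G" if "h \<in> H" for h using that H_subset by blast
  have U: "U h \<otimes> V \<one> = \<theta> h" and V: "U \<one> \<otimes> V h = \<theta> h" if "h \<in> H" for h
    using AUT_apply[OF A, of h \<one>] AUT_apply[OF A, of \<one> h] H[OF that] by simp_all
  have \<theta>H: "\<theta> ` H = H" using \<theta> by (simp add: SSYM_def)
  have "U h \<in> H" if "h \<in> H" for h
    using H_right_division[OF g SYM_closed[OF S(1) H[OF that]]] U[OF that] \<theta>H that by auto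
  moreover have "h \<in> U ` H" if h: "h \<in> H" for h
  proof -
    \<comment> \<open>For \<open>U k = h\<close> the first equation demands
      \<open>\<theta> k = h \<otimes> V \<one>\<close>. The right side lies in \<open>H\<close>, so
      \<theta> being onto \<open>H\<close> provides \<open>k\<close>.\<close>
    obtain k where k: "k \<in> H" "\<theta> k = h \<otimes> V \<one>" using \<theta>H H_mult[OF h g] by (metis imageE)
    then have "U k = h"
      using U[of k] r_cancel[of "U k" "V \<one>" h] H g h S by (simp add: SYM_closed)
    then show ?thesis using k by blast
  qed
  ultimately show "U \<in> SSYM G H" using S by (auto simp: SSYM_def)
  have "V h \<in> H" if "h \<in> H" for h
    using H_left_division[OF f SYM_closed[OF S(2) H[OF that]]] V[OF that] \<theta>H that by auto
  moreover have "h \<in> V ` H" if h: "h \<in> H" for h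
  proof -
    obtain k where k: "k \<in> H" "\<theta> k = U \<one> \<otimes> h" using \<theta>H H_mult[OF f h] by (metis imageE)
    then have "V k = h"
      using V[of k] l_cancel[of "U \<one>" "V k" h] H f h S by (simp add: SYM_closed)
    then show ?thesis using k by blast
  qed
  ultimately show "V \<in> SSYM G H" using S by (auto simp: SSYM_def)
qed

text \<open>The condition on \<open>f\<close> and \<open>g\<close> is replaced by one imposed on
  each component separately, which passes to products and inverses because \<open>SSYM\<close> is a
  subgroup.\<close>

lemma SBS_eq:
  "SBS G H = {\<theta> \<in> SSYM G H. \<exists>U \<in> SSYM G H. \<exists>V \<in> SSYM G H. (U, V, \<theta>) \<in> AUT G}"
proof -
  have "(\<exists>f \<in> H. \<exists>g \<in> H. (\<theta> \<otimes>\<^bsub>SYM G\<^esub> inv\<^bsub>SYM G\<^esub> (Rtrans G g), \<theta> \<otimes>\<^bsub>SYM G\<^esub> inv\<^bsub>SYM G\<^esub> (Ltrans G f), \<theta>) \<in> AUT G)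
      \<longleftrightarrow> (\<exists>U \<in> SSYM G H. \<exists>V \<in> SSYM G H. (U, V, \<theta>) \<in> AUT G)" (is "?L \<longleftrightarrow> ?R")
    if \<theta>: "\<theta> \<in> SSYM G H" for \<theta>
  proof -
    have "\<theta> \<in> carrier (SYM G)" using \<theta> by (simp add: SSYM_def)
    then have "?L \<longleftrightarrow> (\<exists>f \<in> H. \<exists>g \<in> H. \<exists>U V. (U, V, \<theta>) \<in> AUT G \<and> U \<one> = f \<and> V \<one> = g)"
      using H_subset by (intro bex_cong refl AUT_translations_iff) auto
    also have "\<dots> \<longleftrightarrow> (\<exists>U V. (U, V, \<theta>) \<in> AUT G \<and> U \<one> \<in> H \<and> V \<one> \<in> H)" by blast
    also have "\<dots> \<longleftrightarrow> ?R"
    proof -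
      \<comment> \<open>This is the converse of \<open>AUT_SSYM\<close>: a permutation preserving
        \<open>H\<close> sends \<open>\<one>\<close> into \<open>H\<close>.\<close>
      have "U \<one> \<in> H" if "U \<in> SSYM G H" for U
        using that one_in_H by (auto simp: SSYM_def)
      then show ?thesis using AUT_SSYM \<theta> by blast
    qed
    finally show ?thesis .
  qed
  then show ?thesis unfolding SBS_def by blast
qed

lemma SBS_I:
  "\<theta> \<in> SSYM G H \<Longrightarrow> U \<in> SSYM G H \<Longrightarrow> V \<in> SSYM G H \<Longrightarrow> (U, V, \<theta>) \<in> AUT G \<Longrightarrow> \<theta> \<in> SBS G H"
  by (auto simp: SBS_eq)

lemma SBS_E:
  assumes "\<theta> \<in> SBS G H"
  obtains U V where "\<theta> \<in> SSYM G H" "U \<in> SSYM G H" "V \<in> SSYM G H" "(U, V, \<theta>) \<in> AUT G"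
  using assms unfolding SBS_eq by blast

lemma SBS_subset_BS: "SBS G H \<subseteq> BS G"
  by (auto simp: SBS_eq BS_eq)

lemma subgroup_SBS: "subgroup (SBS G H) (SYM G)"
proof -
  interpret S: subgroup "SSYM G H" "SYM G" using H_subset by (rule subgroup_SSYM)
  show ?thesis
  proof (rule group.subgroupI[OF group_SYM])
    have "\<one>\<^bsub>SYM G\<^esub> \<in> SBS G H"
      by (rule SBS_I[OF S.one_closed S.one_closed S.one_closed AUT_id])
    then show "SBS G H \<noteq> {}" by blast
  next
    fix \<alpha> assume "\<alpha> \<in> SBS G H"
    then obtain U V where a: "\<alpha> \<in> SSYM G H" "U \<in> SSYM G H" "V \<in> SSYM G H" "(U, V, \<alpha>) \<in> AUT G"
      by (rule SBS_E)
    show "inv\<^bsub>SYM G\<^esub> \<alpha> \<in> SBS G H"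
      by (rule SBS_I[OF a(1-3)[THEN group.subgroupE(3)[OF group_SYM S.subgroup_axioms]] AUT_inv[OF a(4)]])
  next
    fix \<alpha> \<beta> assume \<alpha>: "\<alpha> \<in> SBS G H" and \<beta>: "\<beta> \<in> SBS G H"
    from \<alpha> obtain U V where a: "\<alpha> \<in> SSYM G H" "U \<in> SSYM G H" "V \<in> SSYM G H" "(U, V, \<alpha>) \<in> AUT G"
      by (rule SBS_E)
    from \<beta> obtain U' V' where b: "\<beta> \<in> SSYM G H" "U' \<in> SSYM G H" "V' \<in> SSYM G H" "(U', V', \<beta>) \<in> AUT G"
      by (rule SBS_E)
    show "\<alpha> \<otimes>\<^bsub>SYM G\<^esub> \<beta> \<in> SBS G H"
      by (rule SBS_I[OF S.m_closed[OF a(1) b(1)] S.m_closed[OF a(2) b(2)] S.m_closed[OF a(3) b(3)]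
            AUT_mult[OF a(4) b(4)]])
  qed (auto simp: SBS_def)
qed

end

theorem theorem3p1:
  fixes G (structure) and H
  assumes "Smarandache_loop G H"
  shows "subgroup (SBS G H) (BS_group G)"
proof -
  interpret Smarandache_loop G H by (rule assms)
  show ?thesis
    unfolding BS_group_def
    \<comment> \<open>\<open>BS_group G\<close> is \<open>SYM G\<close> cut down to
      \<open>BS G\<close>, so two nested subgroups of \<open>SYM G\<close> are enough.\<close>
    by (rule group.subgroup_incl[OF group_SYM subgroup_SBS subgroup_BS SBS_subset_BS])
qed

end
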